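(* Let $\widetilde f$ and $\widetilde g$ be generalized densities on $\mathbb{R}$. Suppose $\widetilde f\in\mathcal{S}$ and $$\lim_{x\to\infty}\widetilde f(x)/\widetilde g(x)=c\quad\text{for some }c\in(0,\infty).$$ If $\widetilde g$ or $\widetilde f$ is almost decreasing (al.d.), or if $\widetilde g(-x)=O(\widetilde f(-x))$ as $x\to\infty$, then $\widetilde g\in\mathcal{S}$.
   Context: A generalized density is $\widetilde f(x)=p\,\delta(x)+q f(x)$ with $p+q=1$, $p,q\ge0$, where $f$ is an (ordinary) probability density on $\mathbb{R}$ and $\delta$ is the Dirac delta at $0$; it represents the measure $p\delta_0(dx)+qf(x)dx$. For $x\ne0$ its value is $qf(x)$. Convolutions are computed as convolutions of measures, e.g. $\widetilde f^{\ast2}=p^2\delta+2pqf+q^2f^{\ast2}$. The tail definitions below are applied to generalized densities through their values at $x\neq 0$. $\alpha(x)\sim\beta(x)$ means $\alpha(x)/\beta(x)\to1$ as $x\to\infty$. A (generalized) density $h$: - is long-tailed, $h\in\mathcal{L}$, if there is $x_0>0$ with $h(x)>0$ for $x\ge x_0$ and, for each fixed $y>0$, $h(x+y)\sim h(x)$; - is subexponential, $h\in\mathcal{S}$, if $h\in\mathcal{L}$ and $h^{\ast2}(x)\sim2h(x)$; - is almost decreasing (al.d.) if there are $x_0>0$ and $K>0$ such that $h(x+y)\le Kh(x)$ for all $x>x_0$, $y>0$. *)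

theory Defs
  imports "HOL-Probability.Probability" "HOL-Library.Landau_Symbols"
begin

text \<open>\<open>GDensity p q f\<close> stands for \<open>p \<delta>(x) + q f(x)\<close>, with \<open>\<delta>\<close> the Dirac delta at 0.\<close>

datatype gdensity = GDensity (atom: real) (weight: real) (dens: "real \<Rightarrow> real")

definition prob_density :: "(real \<Rightarrow> real) \<Rightarrow> bool" where
  "prob_density f \<longleftrightarrow> f \<in> borel_measurable borel \<and> (\<forall>x. 0 \<le> f x) \<and>
     (\<integral>\<^sup>+x. ennreal (f x) \<partial>lborel) = 1"

definition gen_density :: "gdensity \<Rightarrow> bool" where
  "gen_density F \<longleftrightarrow> 0 \<le> atom F \<and> 0 \<le> weight F \<and> atom F + weight F = 1 \<and> prob_density (dens F)"

text \<open>The value of a generalized density at a point \<open>x \<noteq> 0\<close>. The value at 0, where the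
  atom sits, carries no meaning; every notion below only concerns \<open>|x| \<rightarrow> \<infinity>\<close>.\<close>

definition gval :: "gdensity \<Rightarrow> real \<Rightarrow> real" where
  "gval F x = weight F * dens F x"

text \<open>The value at \<open>x \<noteq> 0\<close> of the convolution of two generalized densities: from
  \<open>(p \<delta> + q f) * (p' \<delta> + q' g) = p p' \<delta> + p q' g + q p' f + q q' (f * g)\<close>.
  It is extended-valued, because the integral \<open>(f * g)(x)\<close> may diverge at individual points.\<close>

definition gconv :: "gdensity \<Rightarrow> gdensity \<Rightarrow> real \<Rightarrow> ennreal" where
  "gconv F G x =
     ennreal (atom F * weight G * dens G x + weight F * atom G * dens F x) +
     ennreal (weight F * weight G) *
       (\<integral>\<^sup>+y. ennreal (dens F (x - y)) * ennreal (dens G y) \<partial>lborel)"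

text \<open>\<open>represents M F\<close>: \<open>M\<close> is the measure \<open>p \<delta>\<^sub>0(dx) + q f(x) dx\<close>. The lemma
  \<open>convolution_represents\<close> below shows that \<open>gconv\<close> is the non-atomic part of the
  convolution of measures.\<close>

definition represents :: "real measure \<Rightarrow> gdensity \<Rightarrow> bool" where
  "represents M F \<longleftrightarrow> sets M = sets borel \<and>
     (\<forall>A\<in>sets borel. emeasure M A =
        ennreal (atom F) * indicator A 0 +
        ennreal (weight F) * (\<integral>\<^sup>+x. ennreal (dens F x) * indicator A x \<partial>lborel))"

definition long_tailed :: "(real \<Rightarrow> real) \<Rightarrow> bool" where
  "long_tailed h \<longleftrightarrow> (\<exists>x0>0. \<forall>x\<ge>x0. 0 < h x) \<and> (\<forall>y>0. (\<lambda>x. h (x + y)) \<sim>[at_top] h)"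

text \<open>Finiteness is stated separately because \<open>enn2real \<infinity> = 0\<close>.\<close>

definition subexponential :: "gdensity \<Rightarrow> bool" where
  "subexponential F \<longleftrightarrow> long_tailed (gval F) \<and>
     (\<forall>\<^sub>F x in at_top. gconv F F x < \<infinity>) \<and>
     (\<lambda>x. enn2real (gconv F F x)) \<sim>[at_top] (\<lambda>x. 2 * gval F x)"

definition almost_decreasing :: "(real \<Rightarrow> real) \<Rightarrow> bool" where
  "almost_decreasing h \<longleftrightarrow> (\<exists>x0>0. \<exists>K>0. \<forall>x>x0. \<forall>y>0. h (x + y) \<le> K * h x)"

lemma represents_nn_integral:
  assumes M: "represents M F" and F: "gen_density F"
    and h[measurable]: "h \<in> borel_measurable borel"
  shows "(\<integral>\<^sup>+x. h x \<partial>M) =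
    ennreal (atom F) * h 0 + ennreal (weight F) * (\<integral>\<^sup>+x. ennreal (dens F x) * h x \<partial>lborel)"
proof -
  have f[measurable]: "dens F \<in> borel_measurable borel"
    using F by (simp add: gen_density_def prob_density_def)
  have sM[measurable_cong]: "sets M = sets borel" using M by (simp add: represents_def)
  from h show ?thesis
  proof (induction rule: borel_measurable_induct)
    case (cong u v)
    then have "u = v" by (auto simp: fun_eq_iff)
    with cong show ?case by simp
  next
    case (set A)
    then show ?case using M sM by (simp add: represents_def)
  next
    case (mult u a)
    have [measurable]: "u \<in> borel_measurable borel" by fact
    have "(\<integral>\<^sup>+x. ennreal (dens F x) * (a * u x) \<partial>lborel) = a * (\<integral>\<^sup>+x. ennreal (dens F x) * u x \<partial>lborel)"
      by (subst nn_integral_cmult[symmetric]) (auto simp: mult_ac)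
    with mult show ?case
      by (simp add: nn_integral_cmult distrib_left mult_ac)
  next
    case (add u v)
    have [measurable]: "u \<in> borel_measurable borel" "v \<in> borel_measurable borel" by fact+
    from add show ?case
      by (simp add: nn_integral_add distrib_left add_ac)
  next
    case (seq U)
    have [measurable]: "\<And>i. U i \<in> borel_measurable borel" by fact
    have mono: "\<And>i x. U i x \<le> U (Suc i) x"
      using seq by (auto simp: incseq_Suc_iff le_fun_def)
    have i1: "incseq (\<lambda>i x. ennreal (dens F x) * U i x)"
      by (auto simp: incseq_Suc_iff le_fun_def intro!: mult_left_mono mono)
    have i2: "incseq (\<lambda>i. ennreal (weight F) * (\<integral>\<^sup>+x. ennreal (dens F x) * U i x \<partial>lborel))"
      by (auto simp: incseq_Suc_iff intro!: mult_left_mono nn_integral_mono mono)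
    have i3: "incseq (\<lambda>i. ennreal (atom F) * U i 0)"
      by (auto simp: incseq_Suc_iff intro!: mult_left_mono mono)
    have "(\<integral>\<^sup>+x. (SUP i. U i) x \<partial>M) = (SUP i. \<integral>\<^sup>+x. U i x \<partial>M)"
      unfolding SUP_apply using seq by (intro nn_integral_monotone_convergence_SUP) auto
    also have "\<dots> = (SUP i. ennreal (atom F) * U i 0) +
        (SUP i. ennreal (weight F) * (\<integral>\<^sup>+x. ennreal (dens F x) * U i x \<partial>lborel))"
      using seq by (simp add: ennreal_SUP_add[OF i3 i2])
    also have "\<dots> = ennreal (atom F) * (SUP i. U i 0) +
        ennreal (weight F) * (\<integral>\<^sup>+x. ennreal (dens F x) * (SUP i. U i x) \<partial>lborel)"
      using i1 by (simp add: SUP_mult_left_ennreal nn_integral_monotone_convergence_SUP)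
    finally show ?case by (simp add: SUP_apply image_comp)
  qed
qed

lemma convolution_represents:
  assumes M: "represents M F" "gen_density F" and N: "represents N G" "gen_density G"
    and A[measurable]: "A \<in> sets borel"
  shows "emeasure (M \<star> N) A =
    ennreal (atom F * atom G) * indicator A 0 + (\<integral>\<^sup>+x. gconv F G x * indicator A x \<partial>lborel)"
proof -
  have f[measurable]: "dens F \<in> borel_measurable borel" and g[measurable]: "dens G \<in> borel_measurable borel"
    and f0: "\<And>x. 0 \<le> dens F x" and g0: "\<And>x. 0 \<le> dens G x"
    and pq: "0 \<le> atom F" "0 \<le> weight F" "0 \<le> atom G" "0 \<le> weight G"
    using M N by (auto simp: gen_density_def prob_density_def)
  have sM[measurable_cong]: "sets M = sets borel" and sN[measurable_cong]: "sets N = sets borel"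
    using M N by (simp_all add: represents_def)
  have fin: "finite_measure K" if "represents K H" "gen_density H" for K H
  proof
    have "space K = UNIV"
      using that sets_eq_imp_space_eq[of K borel] by (simp add: represents_def)
    moreover have "emeasure K UNIV < \<infinity>"
      using that by (simp add: represents_def gen_density_def prob_density_def)
    ultimately show "emeasure K (space K) \<noteq> \<infinity>" by simp
  qed
  define a where "a y = (\<integral>\<^sup>+x. ennreal (dens G x) * indicator A (y + x) \<partial>lborel)" for y
  have [measurable]: "a \<in> borel_measurable borel" unfolding a_def by measurable
  have dbl: "(\<integral>\<^sup>+x. ennreal (dens F x) * a x \<partial>lborel) =
      (\<integral>\<^sup>+x. (\<integral>\<^sup>+y. ennreal (dens F (x - y)) * ennreal (dens G y) \<partial>lborel) * indicator A x \<partial>lborel)"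
  proof -
    have "(\<integral>\<^sup>+x. ennreal (dens F x) * a x \<partial>lborel) =
      (\<integral>\<^sup>+x. \<integral>\<^sup>+y. ennreal (dens F x) * ennreal (dens G y) * indicator A (x + y) \<partial>lborel \<partial>lborel)"
      unfolding a_def by (simp add: nn_integral_cmult[symmetric] mult.assoc)
    also have "\<dots> = (\<integral>\<^sup>+y. \<integral>\<^sup>+x. ennreal (dens F x) * ennreal (dens G y) * indicator A (x + y) \<partial>lborel \<partial>lborel)"
      by (rule lborel_pair.Fubini') measurable
    also have "\<dots> = (\<integral>\<^sup>+y. \<integral>\<^sup>+x. ennreal (dens F (x - y)) * ennreal (dens G y) * indicator A x \<partial>lborel \<partial>lborel)"
    proof (rule nn_integral_cong)
      fix y :: real
      show "(\<integral>\<^sup>+x. ennreal (dens F x) * ennreal (dens G y) * indicator A (x + y) \<partial>lborel) =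
        (\<integral>\<^sup>+x. ennreal (dens F (x - y)) * ennreal (dens G y) * indicator A x \<partial>lborel)"
        by (subst nn_integral_real_affine[where c=1 and t="- y"]) auto
    qed
    also have "\<dots> = (\<integral>\<^sup>+x. \<integral>\<^sup>+y. ennreal (dens F (x - y)) * ennreal (dens G y) * indicator A x \<partial>lborel \<partial>lborel)"
      by (rule lborel_pair.Fubini') measurable
    also have "\<dots> = (\<integral>\<^sup>+x. (\<integral>\<^sup>+y. ennreal (dens F (x - y)) * ennreal (dens G y) \<partial>lborel) * indicator A x \<partial>lborel)"
      by (simp add: nn_integral_multc)
    finally show ?thesis .
  qed
  have "emeasure (M \<star> N) A = (\<integral>\<^sup>+x. \<integral>\<^sup>+y. indicator A (x + y) \<partial>N \<partial>M)"
    using A sM sN fin[OF M] fin[OF N] by (intro convolution_emeasure') auto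
  also have "\<dots> = (\<integral>\<^sup>+x. ennreal (atom G) * indicator A x + ennreal (weight G) * a x \<partial>M)"
    unfolding a_def by (subst represents_nn_integral[OF N]) auto
  also have "\<dots> = ennreal (atom F) * (ennreal (atom G) * indicator A 0 + ennreal (weight G) * a 0) +
      ennreal (weight F) * (\<integral>\<^sup>+x. ennreal (dens F x) * (ennreal (atom G) * indicator A x + ennreal (weight G) * a x) \<partial>lborel)"
    by (subst represents_nn_integral[OF M]) auto
  also have "(\<integral>\<^sup>+x. ennreal (dens F x) * (ennreal (atom G) * indicator A x + ennreal (weight G) * a x) \<partial>lborel) =
      ennreal (atom G) * (\<integral>\<^sup>+x. ennreal (dens F x) * indicator A x \<partial>lborel) +
      ennreal (weight G) * (\<integral>\<^sup>+x. ennreal (dens F x) * a x \<partial>lborel)"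
    by (simp add: distrib_left mult.left_commute nn_integral_add nn_integral_cmult)
  finally have 1: "emeasure (M \<star> N) A = ennreal (atom F * atom G) * indicator A 0 +
      (ennreal (atom F * weight G) * (\<integral>\<^sup>+x. ennreal (dens G x) * indicator A x \<partial>lborel) +
       ennreal (weight F * atom G) * (\<integral>\<^sup>+x. ennreal (dens F x) * indicator A x \<partial>lborel) +
       ennreal (weight F * weight G) * (\<integral>\<^sup>+x. ennreal (dens F x) * a x \<partial>lborel))"
    using pq by (simp add: a_def[of 0] distrib_left ennreal_mult' mult.assoc add.assoc)
  have "(\<integral>\<^sup>+x. gconv F G x * indicator A x \<partial>lborel) =
      (\<integral>\<^sup>+x. ennreal (atom F * weight G) * (ennreal (dens G x) * indicator A x) +
        ennreal (weight F * atom G) * (ennreal (dens F x) * indicator A x) +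
        ennreal (weight F * weight G) *
          ((\<integral>\<^sup>+y. ennreal (dens F (x - y)) * ennreal (dens G y) \<partial>lborel) * indicator A x) \<partial>lborel)"
    using pq f0 g0
    by (intro nn_integral_cong) (simp add: gconv_def ennreal_mult'[symmetric] split: split_indicator)
  also have "\<dots> = ennreal (atom F * weight G) * (\<integral>\<^sup>+x. ennreal (dens G x) * indicator A x \<partial>lborel) +
       ennreal (weight F * atom G) * (\<integral>\<^sup>+x. ennreal (dens F x) * indicator A x \<partial>lborel) +
       ennreal (weight F * weight G) * (\<integral>\<^sup>+x. ennreal (dens F x) * a x \<partial>lborel)"
    unfolding dbl by (simp add: nn_integral_add nn_integral_cmult)
  finally show ?thesis unfolding 1 by simp
qed

end

theory Submission
  imports Defs
begin

text \<open>
  Write \<open>f\<close> and \<open>g\<close> for the values of the two generalized densities off the origin. By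
  the symmetry \<open>y \<mapsto> x - y\<close>, half of the self-convolution integral of \<open>f\<close> comes from
  \<open>y \<le> x/2\<close>, so a long-tailed \<open>f\<close> is subexponential iff
  \<open>\<integral>\<^bsub>y \<le> x/2\<^esub> f (x - y) f y / f x dy \<longrightarrow> \<integral> f\<close> (\<open>subexponential_iff_half_conv\<close>). Here the
  integrand converges pointwise to \<open>f y\<close>, because \<open>f\<close> is long-tailed.

  The tail \<open>g\<close> is long-tailed because it is asymptotically proportional to \<open>f\<close>, so its
  integrands \<open>g (x - y) g y / g x\<close> on \<open>y \<le> x/2\<close> converge pointwise to \<open>g y\<close>. It remains to
  pass to the limit under the integral. For all large \<open>x\<close> these integrands are bounded by
  \<open>C g y + C' f (x - y) f y / f x\<close>: for large \<open>y\<close> because \<open>f\<close> and \<open>g\<close> are comparable at infinity;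
  for \<open>y\<close> in a bounded interval because the oscillation of a measurable
  long-tailed function over bounded intervals is bounded (\<open>long_tailed_bounded_oscillation\<close>,
  the argument of the uniform convergence theorem for slowly varying functions); and for
  \<open>y \<longrightarrow> -\<infinity>\<close> by either alternative of the last hypothesis. The bounds depend on \<open>x\<close>, but
  they converge pointwise and so do their integrals, since \<open>f\<close> is subexponential;
  this is enough for dominated convergence (\<open>dominated_convergence_moving_bound\<close>).
\<close>

section \<open>Dominated convergence with a varying bound\<close>

text \<open>Pratt's lemma. Truncating at the limit \<open>b\<close> of the bounds reduces it to ordinary
  dominated convergence: the truncation error satisfies, for large \<open>t\<close>,
  \<open>0 \<le> a t x - min (a t x) (b x) \<le> B t x - min (B t x) (b x)\<close>, and the integral of the
  right-hand side tends to 0 as \<open>t \<longrightarrow> \<infinity>\<close>.\<close>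

lemma dominated_convergence_moving_bound:
  fixes a B :: "real \<Rightarrow> 'a \<Rightarrow> real" and a' b :: "'a \<Rightarrow> real"
  assumes meas[measurable]: "\<And>t. a t \<in> borel_measurable M" "\<And>t. B t \<in> borel_measurable M"
      "a' \<in> borel_measurable M"
    and b: "integrable M b"
    and B: "\<forall>\<^sub>F t in at_top. integrable M (B t)"
    and bound: "\<forall>\<^sub>F t in at_top. \<forall>x. 0 \<le> a t x \<and> a t x \<le> B t x"
    and lim_a: "\<And>x. ((\<lambda>t. a t x) \<longlongrightarrow> a' x) at_top"
    and lim_B: "\<And>x. ((\<lambda>t. B t x) \<longlongrightarrow> b x) at_top"
    and lim_int: "((\<lambda>t. \<integral>x. B t x \<partial>M) \<longlongrightarrow> (\<integral>x. b x \<partial>M)) at_top"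
  shows "\<forall>\<^sub>F t in at_top. integrable M (a t)"
    and "((\<lambda>t. \<integral>x. a t x \<partial>M) \<longlongrightarrow> (\<integral>x. a' x \<partial>M)) at_top"
proof -
  have [measurable]: "b \<in> borel_measurable M"
    using b by auto
  have a'_le: "0 \<le> a' x \<and> a' x \<le> b x" for x
  proof
    show "0 \<le> a' x"
      using lim_a[of x] bound by (intro tendsto_lowerbound[OF lim_a]) (auto elim: eventually_mono)
    show "a' x \<le> b x"
      using bound by (intro tendsto_le[OF _ lim_B lim_a]) (auto elim: eventually_mono)
  qed
  then have b0: "0 \<le> b x" for x
    using order_trans by blast
  show int: "\<forall>\<^sub>F t in at_top. integrable M (a t)"
    using B bound
  proof eventually_elim
    case (elim t)
    show ?case
      by (rule Bochner_Integration.integrable_bound[OF elim(1)]) (use elim(2) in \<open>auto intro!: AE_I2 order_trans[OF _ abs_ge_self]\<close>)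
  qed
  have trunc_a: "((\<lambda>t. \<integral>x. min (a t x) (b x) \<partial>M) \<longlongrightarrow> (\<integral>x. a' x \<partial>M)) at_top"
  proof (rule integral_dominated_convergence_at_top[OF _ _ b])
    have "((\<lambda>t. min (a t x) (b x)) \<longlongrightarrow> a' x) at_top" for x
      using tendsto_min[OF lim_a[of x] tendsto_const[of "b x"]] a'_le[of x] by (simp add: min_absorb1)
    then show "AE x in M. ((\<lambda>t. min (a t x) (b x)) \<longlongrightarrow> a' x) at_top" by simp
    show "\<forall>\<^sub>F t in at_top. AE x in M. norm (min (a t x) (b x)) \<le> b x"
      using bound by eventually_elim (use b0 in auto)
  qed measurable
  have trunc_B: "((\<lambda>t. \<integral>x. min (B t x) (b x) \<partial>M) \<longlongrightarrow> (\<integral>x. b x \<partial>M)) at_top"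
  proof (rule integral_dominated_convergence_at_top[OF _ _ b])
    have "((\<lambda>t. min (B t x) (b x)) \<longlongrightarrow> b x) at_top" for x
      using tendsto_min[OF lim_B[of x] tendsto_const[of "b x"]] by simp
    then show "AE x in M. ((\<lambda>t. min (B t x) (b x)) \<longlongrightarrow> b x) at_top" by simp
    show "\<forall>\<^sub>F t in at_top. AE x in M. norm (min (B t x) (b x)) \<le> b x"
      using bound
    proof eventually_elim
      case (elim t)
      have "norm (min (B t x) (b x)) \<le> b x" for x
        using b0[of x] elim[rule_format, of x] by auto
      then show ?case by simp
    qed
  qed measurable
  have err: "\<forall>\<^sub>F t in at_top. 0 \<le> (\<integral>x. a t x \<partial>M) - (\<integral>x. min (a t x) (b x) \<partial>M) \<and>
      (\<integral>x. a t x \<partial>M) - (\<integral>x. min (a t x) (b x) \<partial>M) \<le> (\<integral>x. B t x \<partial>M) - (\<integral>x. min (B t x) (b x) \<partial>M)"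
    using B bound int
  proof eventually_elim
    case (elim t)
    have ia: "integrable M (\<lambda>x. min (a t x) (b x))" and iB: "integrable M (\<lambda>x. min (B t x) (b x))"
      using elim b by auto
    have "0 \<le> (\<integral>x. a t x - min (a t x) (b x) \<partial>M)"
      by (intro Bochner_Integration.integral_nonneg) auto
    moreover have "(\<integral>x. a t x - min (a t x) (b x) \<partial>M) \<le> (\<integral>x. B t x - min (B t x) (b x) \<partial>M)"
    proof (intro integral_mono)
      fix x show "a t x - min (a t x) (b x) \<le> B t x - min (B t x) (b x)"
        using elim(2)[rule_format, of x] by (auto simp: min_def)
    qed (use elim ia iB in auto)
    ultimately show ?case using elim ia iB by simp
  qed
  have "((\<lambda>t. (\<integral>x. B t x \<partial>M) - (\<integral>x. min (B t x) (b x) \<partial>M)) \<longlongrightarrow> 0) at_top"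
    using tendsto_diff[OF lim_int trunc_B] by simp
  then have "((\<lambda>t. (\<integral>x. a t x \<partial>M) - (\<integral>x. min (a t x) (b x) \<partial>M)) \<longlongrightarrow> 0) at_top"
    by (rule tendsto_sandwich[OF _ _ tendsto_const, rotated 2]) (use err in \<open>auto elim: eventually_mono\<close>)
  from tendsto_add[OF this trunc_a]
  show "((\<lambda>t. \<integral>x. a t x \<partial>M) \<longlongrightarrow> (\<integral>x. a' x \<partial>M)) at_top" by simp
qed

section \<open>Long-tailed functions\<close>

lemma long_tailed_eventually_pos: "long_tailed h \<Longrightarrow> \<forall>\<^sub>F x in at_top. 0 < h x"
  unfolding long_tailed_def eventually_at_top_linorder by blast

lemma long_tailed_ratio:
  assumes h: "long_tailed h"
  shows "((\<lambda>x. h (x + y) / h x) \<longlongrightarrow> 1) at_top"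
proof -
  have pos: "((\<lambda>x. h (x + y) / h x) \<longlongrightarrow> 1) at_top" if "0 < y" for y
    using h that long_tailed_eventually_pos[OF h]
    by (intro asymp_equivD_strong) (auto simp: long_tailed_def elim: eventually_mono)
  consider "0 < y" | "y = 0" | "y < 0" by linarith
  then show ?thesis
  proof cases
    case 1 then show ?thesis by (rule pos)
  next
    case 2
    then show ?thesis
      using long_tailed_eventually_pos[OF h]
      by (intro tendsto_eventually) (auto elim: eventually_mono)
  next
    case 3
    have "filterlim (\<lambda>x. x + y) at_top at_top"
      using filterlim_tendsto_add_at_top[OF tendsto_const[of y] filterlim_ident] by (simp add: add.commute)
    from filterlim_compose[OF pos[of "- y"] this] 3
    have "((\<lambda>x. h x / h (x + y)) \<longlongrightarrow> 1) at_top" by simp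
    from tendsto_inverse[OF this] show ?thesis by simp
  qed
qed

lemma long_tailedI_ratio:
  assumes pos: "\<forall>\<^sub>F x in at_top. 0 < h x"
    and lim: "\<And>y. 0 < y \<Longrightarrow> ((\<lambda>x. h (x + y) / h x) \<longlongrightarrow> 1) at_top"
  shows "long_tailed h"
proof -
  from pos obtain N where "\<And>x. N \<le> x \<Longrightarrow> 0 < h x"
    by (auto simp: eventually_at_top_linorder)
  then have "\<exists>x0>0. \<forall>x\<ge>x0. 0 < h x"
    by (intro exI[of _ "max N 1"]) auto
  with lim show ?thesis by (auto simp: long_tailed_def intro!: asymp_equivI')
qed

text \<open>For large \<open>x\<close> the set \<open>S x\<close> of those \<open>t \<in> [x, x + 2A]\<close> at which \<open>h t\<close> is within a factor 2
  of \<open>h x\<close> has measure above \<open>3A/2\<close>. If \<open>x \<le> x' \<le> x + A\<close>, then \<open>S x\<close> and \<open>S x'\<close> both lie in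
  \<open>[x, x + 3A]\<close>, so they intersect, and \<open>h x\<close>, \<open>h x'\<close> differ by a factor of at most 4.\<close>

lemma long_tailed_bounded_oscillation:
  assumes h: "long_tailed h" and [measurable]: "h \<in> borel_measurable borel" and A: "0 < A"
  shows "\<forall>\<^sub>F x in at_top. \<forall>u. \<bar>u\<bar> \<le> A \<longrightarrow> h (x + u) \<le> 4 * h x"
proof -
  define S where "S x = {t. x \<le> t \<and> t \<le> x + 2 * A \<and> h x / 2 < h t \<and> h t < 2 * h x}" for x
  have S_sets[measurable]: "S x \<in> sets borel" for x unfolding S_def by measurable
  have S_fin: "emeasure lborel (S x) < \<infinity>" for x
  proof -
    have "emeasure lborel (S x) \<le> emeasure lborel {x..x + 2 * A}"
      by (intro emeasure_mono) (auto simp: S_def)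
    also have "\<dots> < \<infinity>" using A by simp
    finally show ?thesis .
  qed
  have S_int: "integrable lborel (indicator (S x) :: real \<Rightarrow> real)" for x
    using S_fin[of x] by (intro integrable_real_indicator) auto
  have meas_S: "measure lborel (S x) = (\<integral>t. indicator (S x) (x + t) \<partial>lborel)" for x
    using lborel_integral_real_affine[of 1 "indicator (S x) :: real \<Rightarrow> real" x] S_fin[of x] by simp
  have "((\<lambda>x. \<integral>t. indicator (S x) (x + t) \<partial>lborel) \<longlongrightarrow> (\<integral>t. indicator {0..2 * A} t \<partial>lborel :: real)) at_top"
  proof (rule integral_dominated_convergence_at_top[where w="indicator {0..2 * A}"])
    have "((\<lambda>x. indicator (S x) (x + t)) \<longlongrightarrow> (indicator {0..2 * A} t :: real)) at_top" for t
    proof (rule tendsto_eventually)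
      have "\<forall>\<^sub>F x in at_top. 1 / 2 < h (x + t) / h x" "\<forall>\<^sub>F x in at_top. h (x + t) / h x < 2"
        by (rule order_tendstoD[OF long_tailed_ratio[OF h]]; simp)+
      then show "\<forall>\<^sub>F x in at_top. indicator (S x) (x + t) = (indicator {0..2 * A} t :: real)"
        using long_tailed_eventually_pos[OF h]
        by eventually_elim (auto simp: S_def field_simps split: split_indicator)
    qed
    then show "AE t in lborel. ((\<lambda>x. indicator (S x) (x + t)) \<longlongrightarrow> (indicator {0..2 * A} t :: real)) at_top"
      by simp
    show "\<forall>\<^sub>F x in at_top. AE t in lborel. norm (indicator (S x) (x + t) :: real) \<le> indicator {0..2 * A} t"
      by (intro always_eventually allI AE_I2) (auto simp: S_def split: split_indicator)
    show "integrable lborel (indicator {0..2 * A} :: real \<Rightarrow> real)"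
      using A by (intro integrable_real_indicator) auto
  qed auto
  then have lim: "((\<lambda>x. measure lborel (S x)) \<longlongrightarrow> 2 * A) at_top"
    using A by (simp add: meas_S)
  have "\<forall>\<^sub>F x in at_top. 3 / 2 * A < measure lborel (S x)"
    by (rule order_tendstoD[OF lim]) (use A in simp)
  then obtain N where N: "\<And>x. N \<le> x \<Longrightarrow> 3 / 2 * A < measure lborel (S x)"
    by (auto simp: eventually_at_top_linorder)
  have meet: "S x \<inter> S x' \<noteq> {}" if "N \<le> x" "x \<le> x'" "x' \<le> x + A" for x x'
  proof
    assume disj: "S x \<inter> S x' = {}"
    have "measure lborel (S x) + measure lborel (S x') = measure lborel (S x \<union> S x')"
      using S_fin[of x] S_fin[of x'] disj by (intro measure_Union[symmetric]) auto
    also have "\<dots> \<le> measure lborel {x..x + 3 * A}"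
      using that A by (intro measure_mono_fmeasurable) (auto simp: S_def fmeasurable_def)
    also have "\<dots> = 3 * A" using A by simp
    finally show False using N[of x] N[of x'] that by simp
  qed
  show ?thesis
    using eventually_ge_at_top[of "N + A"]
  proof eventually_elim
    case (elim x)
    show ?case
    proof (intro allI impI)
      fix u assume u: "\<bar>u\<bar> \<le> A"
      have "S x \<inter> S (x + u) \<noteq> {}"
      proof (cases "0 \<le> u")
        case True
        then show ?thesis using elim u A by (intro meet) auto
      next
        case False
        then show ?thesis using meet[of "x + u" x] elim u A by (auto simp: Int_commute)
      qed
      then show "h (x + u) \<le> 4 * h x" by (force simp: S_def)
    qed
  qed
qed

section \<open>Subexponentiality through the half convolution\<close>

text \<open>The integrand of \<open>(h * h)(x)\<close>, restricted to \<open>y \<le> x/2\<close>.\<close>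

definition half_conv :: "(real \<Rightarrow> real) \<Rightarrow> real \<Rightarrow> real \<Rightarrow> real" where
  "half_conv h x y = indicator {..x / 2} y * (h (x - y) * h y)"

lemma half_conv_measurable[measurable]:
  assumes [measurable]: "h \<in> borel_measurable borel"
  shows "half_conv h x \<in> borel_measurable borel"
  unfolding half_conv_def by measurable

lemma half_conv_nonneg: "(\<And>z. 0 \<le> h z) \<Longrightarrow> 0 \<le> half_conv h x y"
  by (simp add: half_conv_def)

lemma nn_integral_half_conv:
  assumes [measurable]: "h \<in> borel_measurable borel"
  shows "(\<integral>\<^sup>+y. ennreal (h (x - y) * h y) \<partial>lborel) = 2 * (\<integral>\<^sup>+y. ennreal (half_conv h x y) \<partial>lborel)"
proof -
  have refl: "(\<integral>\<^sup>+y. ennreal (half_conv h x y) \<partial>lborel) = (\<integral>\<^sup>+y. ennreal (half_conv h x (x - y)) \<partial>lborel)"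
    by (subst nn_integral_real_affine[where c="-1" and t=x]) auto
  have "(\<integral>\<^sup>+y. ennreal (h (x - y) * h y) \<partial>lborel) =
      (\<integral>\<^sup>+y. ennreal (half_conv h x y) + ennreal (half_conv h x (x - y)) \<partial>lborel)"
  proof (rule nn_integral_cong_AE)
    \<comment> \<open>The point \<open>y = x / 2\<close> belongs to both halves, but it is a null set.\<close>
    show "AE y in lborel. ennreal (h (x - y) * h y) =
        ennreal (half_conv h x y) + ennreal (half_conv h x (x - y))"
      using AE_lborel_singleton[of "x / 2"]
      by eventually_elim (auto simp: half_conv_def mult.commute split: split_indicator)
  qed
  also have "\<dots> = 2 * (\<integral>\<^sup>+y. ennreal (half_conv h x y) \<partial>lborel)"
    by (subst nn_integral_add) (auto simp: refl[symmetric] mult_2)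
  finally show ?thesis .
qed

lemma gval_gen_density:
  assumes "gen_density F"
  shows "gval F \<in> borel_measurable borel" and "0 \<le> gval F x"
    and "integrable lborel (gval F)" and "(\<integral>x. gval F x \<partial>lborel) = weight F"
proof -
  have [measurable]: "dens F \<in> borel_measurable borel" and d0: "\<And>x. 0 \<le> dens F x"
    and d1: "(\<integral>\<^sup>+x. ennreal (dens F x) \<partial>lborel) = 1" and w: "0 \<le> weight F"
    using assms by (auto simp: gen_density_def prob_density_def)
  have eq: "gval F = (\<lambda>x. weight F * dens F x)" by (simp add: gval_def fun_eq_iff)
  show "gval F \<in> borel_measurable borel" unfolding eq by measurable
  show "0 \<le> gval F x" using w d0 by (simp add: gval_def)
  have "has_bochner_integral lborel (dens F) 1"
    using d0 d1 by (intro has_bochner_integral_nn_integral) auto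
  from has_bochner_integral_mult_right[OF this, of "weight F"]
  show "integrable lborel (gval F)" "(\<integral>x. gval F x \<partial>lborel) = weight F"
    unfolding eq by (auto simp: has_bochner_integral_iff)
qed

lemma gconv_self:
  assumes "gen_density F"
  shows "gconv F F x = ennreal (2 * atom F * gval F x) + 2 * (\<integral>\<^sup>+y. ennreal (half_conv (gval F) x y) \<partial>lborel)"
proof -
  have [measurable]: "dens F \<in> borel_measurable borel" and d0: "\<And>x. 0 \<le> dens F x" and w: "0 \<le> weight F"
    using assms by (auto simp: gen_density_def prob_density_def)
  have "(\<integral>\<^sup>+y. ennreal (gval F (x - y) * gval F y) \<partial>lborel) =
      ennreal (weight F * weight F) * (\<integral>\<^sup>+y. ennreal (dens F (x - y)) * ennreal (dens F y) \<partial>lborel)"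
    using w d0 by (subst nn_integral_cmult[symmetric])
      (auto simp: gval_def ennreal_mult'[symmetric] mult_ac intro!: nn_integral_cong)
  then show ?thesis
    unfolding gconv_def nn_integral_half_conv[OF gval_gen_density(1)[OF assms], symmetric]
    by (simp add: gval_def algebra_simps)
qed

lemma gconv_self_finite_iff:
  assumes F: "gen_density F"
  shows "gconv F F x < \<infinity> \<longleftrightarrow> integrable lborel (half_conv (gval F) x)"
proof -
  note [measurable] = gval_gen_density(1)[OF F]
  have nonneg: "0 \<le> half_conv (gval F) x y" for y
    by (rule half_conv_nonneg) (rule gval_gen_density(2)[OF F])
  show ?thesis
    by (auto simp: gconv_self[OF F] integrable_iff_bounded ennreal_mult_less_top nonneg)
qed

lemma gconv_self_integrable:
  assumes F: "gen_density F" and int: "integrable lborel (half_conv (gval F) x)"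
  shows "enn2real (gconv F F x) = 2 * atom F * gval F x + 2 * (\<integral>y. half_conv (gval F) x y \<partial>lborel)"
proof -
  have nonneg: "0 \<le> half_conv (gval F) x y" for y
    by (rule half_conv_nonneg) (rule gval_gen_density(2)[OF F])
  have a: "0 \<le> atom F * gval F x"
    using F gval_gen_density(2)[OF F] by (simp add: gen_density_def)
  have i: "0 \<le> (\<integral>y. half_conv (gval F) x y \<partial>lborel)" using nonneg by simp
  have "gconv F F x = ennreal (2 * atom F * gval F x + 2 * (\<integral>y. half_conv (gval F) x y \<partial>lborel))"
    using a i nonneg int
    by (simp add: gconv_self[OF F] nn_integral_eq_integral ennreal_plus ennreal_mult)
  then show ?thesis using a i by (simp del: ennreal_plus)
qed

lemma subexponential_iff_half_conv:
  assumes F: "gen_density F" and lt: "long_tailed (gval F)"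
  shows "subexponential F \<longleftrightarrow>
    (\<forall>\<^sub>F x in at_top. integrable lborel (half_conv (gval F) x)) \<and>
    ((\<lambda>x. (\<integral>y. half_conv (gval F) x y \<partial>lborel) / gval F x) \<longlongrightarrow> (\<integral>y. gval F y \<partial>lborel)) at_top"
proof -
  note pos = long_tailed_eventually_pos[OF lt]
  let ?I = "\<lambda>x. (\<integral>y. half_conv (gval F) x y \<partial>lborel) / gval F x"
  have "(\<lambda>x. enn2real (gconv F F x)) \<sim>[at_top] (\<lambda>x. 2 * gval F x) \<longleftrightarrow>
      (?I \<longlongrightarrow> (\<integral>y. gval F y \<partial>lborel)) at_top"
    if int: "\<forall>\<^sub>F x in at_top. integrable lborel (half_conv (gval F) x)"
  proof -
    have "(\<lambda>x. enn2real (gconv F F x)) \<sim>[at_top] (\<lambda>x. 2 * gval F x) \<longleftrightarrow>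
        ((\<lambda>x. enn2real (gconv F F x) / (2 * gval F x)) \<longlongrightarrow> 1) at_top"
      using pos by (auto intro!: asymp_equivI' asymp_equivD_strong elim: eventually_mono)
    also have "\<dots> \<longleftrightarrow> ((\<lambda>x. atom F + ?I x) \<longlongrightarrow> atom F + weight F) at_top"
    proof (rule tendsto_cong[THEN trans])
      show "\<forall>\<^sub>F x in at_top. enn2real (gconv F F x) / (2 * gval F x) = atom F + ?I x"
        using int pos by eventually_elim (simp add: gconv_self_integrable[OF F] field_simps)
      show "((\<lambda>x. atom F + ?I x) \<longlongrightarrow> 1) at_top \<longleftrightarrow> ((\<lambda>x. atom F + ?I x) \<longlongrightarrow> atom F + weight F) at_top"
        using F by (simp add: gen_density_def)
    qed
    also have "\<dots> \<longleftrightarrow> (?I \<longlongrightarrow> weight F) at_top"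
      using tendsto_add_const_iff[of "atom F" ?I "weight F" at_top] by simp
    finally show ?thesis using gval_gen_density(4)[OF F] by simp
  qed
  with lt show ?thesis unfolding subexponential_def gconv_self_finite_iff[OF F] by blast
qed

lemma tendsto_half_conv:
  assumes "long_tailed h"
  shows "((\<lambda>x. half_conv h x y / h x) \<longlongrightarrow> h y) at_top"
proof -
  have "\<forall>\<^sub>F x in at_top. h (x + - y) / h x * h y = half_conv h x y / h x"
    using eventually_ge_at_top[of "2 * y"]
    by eventually_elim (simp add: half_conv_def)
  moreover have "((\<lambda>x. h (x + - y) / h x * h y) \<longlongrightarrow> 1 * h y) at_top"
    by (intro tendsto_intros long_tailed_ratio assms)
  ultimately have "((\<lambda>x. half_conv h x y / h x) \<longlongrightarrow> 1 * h y) at_top"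
    by (rule Lim_transform_eventually[rotated])
  then show ?thesis by simp
qed

section \<open>Transfer to an asymptotically proportional density\<close>

lemma long_tailed_transfer:
  assumes f: "long_tailed f" and g0: "\<And>x. 0 \<le> g x" and c: "0 < c"
    and lim: "((\<lambda>x. f x / g x) \<longlongrightarrow> c) at_top"
  shows "long_tailed g"
proof (rule long_tailedI_ratio)
  have "\<forall>\<^sub>F x in at_top. 0 < f x / g x" by (rule order_tendstoD(1)[OF lim c])
  then show pos: "\<forall>\<^sub>F x in at_top. 0 < g x"
    by eventually_elim (use g0 in \<open>auto simp: less_le\<close>)
  fix y :: real assume "0 < y"
  have shift: "filterlim (\<lambda>x. x + y) at_top at_top"
    using filterlim_tendsto_add_at_top[OF tendsto_const[of y] filterlim_ident] by (simp add: add.commute)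
  have "((\<lambda>x. (f x / g x) / (f (x + y) / g (x + y)) * (f (x + y) / f x)) \<longlongrightarrow> c / c * 1) at_top"
    using c by (intro tendsto_intros lim filterlim_compose[OF lim shift] long_tailed_ratio[OF f]) auto
  moreover have "\<forall>\<^sub>F x in at_top. (f x / g x) / (f (x + y) / g (x + y)) * (f (x + y) / f x) = g (x + y) / g x"
    using long_tailed_eventually_pos[OF f]
      eventually_compose_filterlim[OF long_tailed_eventually_pos[OF f] shift]
    by eventually_elim simp
  ultimately have "((\<lambda>x. g (x + y) / g x) \<longlongrightarrow> c / c * 1) at_top"
    by (rule Lim_transform_eventually)
  then show "((\<lambda>x. g (x + y) / g x) \<longlongrightarrow> 1) at_top"
    using c by simp
qed

lemma eventually_comparable:
  fixes f g :: "real \<Rightarrow> real"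
  assumes g0: "\<And>x. 0 \<le> g x" and c: "0 < c" and lim: "((\<lambda>x. f x / g x) \<longlongrightarrow> c) at_top"
  obtains K where "0 < K" "\<forall>\<^sub>F x in at_top. f x \<le> K * g x \<and> g x \<le> K * f x"
proof
  show "0 < 2 * c + 2 / c" using c by (simp add: add_pos_pos)
  have "\<forall>\<^sub>F x in at_top. c / 2 < f x / g x" "\<forall>\<^sub>F x in at_top. f x / g x < 2 * c"
    by (rule order_tendstoD[OF lim]; use c in simp)+
  then show "\<forall>\<^sub>F x in at_top. f x \<le> (2 * c + 2 / c) * g x \<and> g x \<le> (2 * c + 2 / c) * f x"
  proof eventually_elim
    case (elim x)
    have "g x \<noteq> 0" using elim c by auto
    then have g: "0 < g x" using g0[of x] by simp
    with elim have lo: "c / 2 * g x < f x" and hi: "f x < 2 * c * g x"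
      by (simp_all add: field_simps)
    have f: "0 < f x" using lo c g by (smt (verit) divide_pos_pos mult_pos_pos)
    have "g x \<le> 2 / c * f x" using lo c by (simp add: field_simps)
    moreover have "0 \<le> 2 * c * f x" "0 \<le> 2 / c * g x" using c f g by auto
    ultimately show ?case using hi by (auto simp: distrib_right)
  qed
qed

lemma almost_decreasing_transfer:
  assumes f: "almost_decreasing f" and K: "0 < K"
    and cmp: "\<forall>\<^sub>F x in at_top. f x \<le> K * g x \<and> g x \<le> K * f x"
  shows "almost_decreasing g"
proof -
  from f obtain x0 L where x0: "0 < x0" and L: "0 < L" "\<And>x y. x0 < x \<Longrightarrow> 0 < y \<Longrightarrow> f (x + y) \<le> L * f x"
    unfolding almost_decreasing_def by blast
  from cmp obtain N where N: "\<And>x. N \<le> x \<Longrightarrow> f x \<le> K * g x \<and> g x \<le> K * f x"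
    by (auto simp: eventually_at_top_linorder)
  have "g (x + y) \<le> (K * L * K) * g x" if "max x0 N < x" "0 < y" for x y
  proof -
    have "g (x + y) \<le> K * f (x + y)" using N[of "x + y"] that by simp
    also have "\<dots> \<le> K * (L * f x)" using L that K by (intro mult_left_mono) auto
    also have "\<dots> \<le> K * (L * (K * g x))" using N[of x] L that K by (intro mult_left_mono) auto
    finally show ?thesis by (simp add: mult_ac)
  qed
  moreover have "0 < max x0 N" "0 < K * L * K" using x0 K L by auto
  ultimately show ?thesis unfolding almost_decreasing_def by blast
qed

text \<open>The term \<open>C * g y\<close> takes care of those \<open>y\<close> for which \<open>g (x - y) / g x\<close> is bounded: \<open>y\<close> in a
  bounded interval, and negative \<open>y\<close> of large modulus if \<open>g\<close> is almost decreasing. The other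
  term takes care of those \<open>y\<close> for which \<open>g y\<close> is at most a multiple of \<open>f y\<close>: large
  \<open>y\<close>, and negative \<open>y\<close> of large modulus under the \<open>O\<close>-condition.\<close>

lemma half_conv_bound:
  fixes f g :: "real \<Rightarrow> real"
  assumes gm: "g \<in> borel_measurable borel" and f0: "\<And>x. 0 \<le> f x" and g0: "\<And>x. 0 \<le> g x"
    and fl: "long_tailed f" and gl: "long_tailed g" and K: "0 < K"
    and cmp: "\<forall>\<^sub>F x in at_top. f x \<le> K * g x \<and> g x \<le> K * f x"
    and neg: "almost_decreasing g \<or> (\<lambda>x. g (- x)) \<in> O[at_top](\<lambda>x. f (- x))"
  obtains C D where "0 \<le> C" "0 \<le> D"
    "\<forall>\<^sub>F x in at_top. \<forall>y. half_conv g x y / g x \<le> C * g y + D * (half_conv f x y / f x)"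
proof -
  obtain N where N: "\<And>x. N \<le> x \<Longrightarrow> f x \<le> K * g x \<and> g x \<le> K * f x"
    using cmp by (auto simp: eventually_at_top_linorder)
  obtain L M where L: "0 \<le> L" and M:
    "(\<forall>x\<ge>M. \<forall>y>0. g (x + y) \<le> L * g x) \<or> (\<forall>x\<ge>M. g (- x) \<le> L * f (- x))"
    using neg
  proof
    assume "almost_decreasing g"
    then obtain x0 L where "0 < L" "\<And>x y. x0 < x \<Longrightarrow> 0 < y \<Longrightarrow> g (x + y) \<le> L * g x"
      unfolding almost_decreasing_def by blast
    then show thesis by (intro that[of L "x0 + 1"]) auto
  next
    assume "(\<lambda>x. g (- x)) \<in> O[at_top](\<lambda>x. f (- x))"
    then obtain L where "0 < L" "\<forall>\<^sub>F x in at_top. norm (g (- x)) \<le> L * norm (f (- x))"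
      by (elim landau_o.bigE)
    moreover from this obtain M where "\<And>x. M \<le> x \<Longrightarrow> norm (g (- x)) \<le> L * norm (f (- x))"
      by (auto simp: eventually_at_top_linorder)
    ultimately show thesis using f0 g0 by (intro that[of L M]) auto
  qed
  \<comment> \<open>Beyond distance \<open>A\<close> from the origin all eventual bounds on \<open>f\<close> and \<open>g\<close> hold.\<close>
  define A where "A = max 1 (max N M)"
  define D where "D = K * (K + L) * K"
  have A: "0 < A" "N \<le> A" "M \<le> A" by (auto simp: A_def)
  have D: "0 \<le> D" using K L by (simp add: D_def)
  show thesis
  proof (rule that[of "4 + L" D])
    show "0 \<le> 4 + L" "0 \<le> D" using L D by auto
    show "\<forall>\<^sub>F x in at_top. \<forall>y. half_conv g x y / g x \<le> (4 + L) * g y + D * (half_conv f x y / f x)"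
      using long_tailed_eventually_pos[OF fl] long_tailed_eventually_pos[OF gl]
        long_tailed_bounded_oscillation[OF gl gm A(1)] eventually_ge_at_top[of "2 * A"]
    proof eventually_elim
      case (elim x)
      have fx: "0 < f x" and gx: "0 < g x" and osc: "\<And>u. \<bar>u\<bar> \<le> A \<Longrightarrow> g (x + u) \<le> 4 * g x" and x: "2 * A \<le> x"
        using elim by auto
      have by_g: "g (x - y) * g y / g x \<le> (4 + L) * g y + D * (f (x - y) * f y / f x)"
        if le: "g (x - y) \<le> (4 + L) * g x" for y
      proof -
        have "g (x - y) * g y \<le> (4 + L) * g x * g y" using le g0 by (intro mult_right_mono)
        then have "g (x - y) * g y / g x \<le> (4 + L) * g y" using gx by (simp add: field_simps)
        moreover have "0 \<le> D * (f (x - y) * f y / f x)" using D f0 by simp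
        ultimately show ?thesis by linarith
      qed
      have by_f: "g (x - y) * g y / g x \<le> (4 + L) * g y + D * (f (x - y) * f y / f x)"
        if le: "g y \<le> (K + L) * f y" and "N \<le> x - y" for y
      proof -
        have "g (x - y) * g y \<le> (K * f (x - y)) * ((K + L) * f y)"
          using N[of "x - y"] that f0 g0 K by (intro mult_mono) auto
        moreover have "0 \<le> (K * f (x - y)) * ((K + L) * f y)" "0 \<le> 1 / g x"
          using f0 g0 K L by simp_all
        moreover have "1 / g x \<le> K / f x"
          using N[of x] x A fx gx K by (simp add: field_simps)
        ultimately have "g (x - y) * g y * (1 / g x) \<le> (K * f (x - y)) * ((K + L) * f y) * (K / f x)"
          by - (rule mult_mono)
        also have "\<dots> = D * (f (x - y) * f y / f x)" by (simp add: D_def)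
        finally have "g (x - y) * g y / g x \<le> D * (f (x - y) * f y / f x)" by simp
        moreover have "0 \<le> (4 + L) * g y" using L g0 by simp
        ultimately show ?thesis by linarith
      qed
      have main: "g (x - y) * g y / g x \<le> (4 + L) * g y + D * (f (x - y) * f y / f x)" if y: "y \<le> x / 2" for y
      proof -
        consider "A \<le> y" | "\<bar>y\<bar> \<le> A" | "y \<le> - A" "y < 0" using A by linarith
        then show ?thesis
        proof cases
          case 1
          have "g y \<le> (K + L) * f y"
            using N[of y] 1 A L f0[of y] by (simp add: distrib_right add_increasing2)
          then show ?thesis using x y A by (intro by_f) auto
        next
          case 2
          have "g (x - y) \<le> (4 + L) * g x"
            using osc[of "- y"] 2 L gx by (simp add: distrib_right add_increasing2)
          then show ?thesis by (rule by_g)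
        next
          case 3
          from M show ?thesis
          proof
            assume *: "\<forall>x\<ge>M. \<forall>y>0. g (x + y) \<le> L * g x"
            have "g (x + - y) \<le> L * g x" using *[rule_format, of x "- y"] 3 x A by simp
            then show ?thesis using gx by (intro by_g) (simp add: distrib_right)
          next
            assume *: "\<forall>x\<ge>M. g (- x) \<le> L * f (- x)"
            have "g y \<le> L * f y" using *[rule_format, of "- y"] 3 A by simp
            then show ?thesis using K f0[of y] 3 x A
              by (intro by_f) (simp_all add: distrib_right add_increasing)
          qed
        qed
      qed
      show ?case
      proof
        fix y
        have "0 \<le> (4 + L) * g y" using L g0 by simp
        with main[of y] show "half_conv g x y / g x \<le> (4 + L) * g y + D * (half_conv f x y / f x)"
          by (cases "y \<le> x / 2") (simp_all add: half_conv_def)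
      qed
    qed
  qed
qed

theorem lemma3p11:
  fixes F G :: gdensity and c :: real
  assumes "gen_density F" and "gen_density G"
    and "subexponential F"
    and "0 < c" and "((\<lambda>x. gval F x / gval G x) \<longlongrightarrow> c) at_top"
    and "almost_decreasing (gval G) \<or> almost_decreasing (gval F) \<or>
         (\<lambda>x. gval G (- x)) \<in> O[at_top](\<lambda>x. gval F (- x))"
  shows "subexponential G"
proof -
  note F = gval_gen_density[OF assms(1)] and G = gval_gen_density[OF assms(2)]
  note [measurable] = F(1) G(1)
  have Fl: "long_tailed (gval F)" using assms(3) by (simp add: subexponential_def)
  have Gl: "long_tailed (gval G)" using Fl G(2) assms(4,5) by (rule long_tailed_transfer)
  obtain K where K: "0 < K" and cmp: "\<forall>\<^sub>F x in at_top. gval F x \<le> K * gval G x \<and> gval G x \<le> K * gval F x"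
    using eventually_comparable[OF G(2) assms(4,5)] .
  have "almost_decreasing (gval G) \<or> (\<lambda>x. gval G (- x)) \<in> O[at_top](\<lambda>x. gval F (- x))"
    using assms(6) almost_decreasing_transfer[OF _ K cmp] by blast
  then obtain C D where CD: "0 \<le> C" "0 \<le> D" and bound: "\<forall>\<^sub>F x in at_top. \<forall>y.
      half_conv (gval G) x y / gval G x \<le> C * gval G y + D * (half_conv (gval F) x y / gval F x)"
    using half_conv_bound[OF G(1) F(2) G(2) Fl Gl K cmp] by blast
  have intF: "\<forall>\<^sub>F x in at_top. integrable lborel (half_conv (gval F) x)"
    and limF: "((\<lambda>x. (\<integral>y. half_conv (gval F) x y \<partial>lborel) / gval F x) \<longlongrightarrow> (\<integral>y. gval F y \<partial>lborel)) at_top"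
    using assms(3) subexponential_iff_half_conv[OF assms(1) Fl] by auto
  let ?a = "\<lambda>x y. half_conv (gval G) x y / gval G x"
  let ?B = "\<lambda>x y. C * gval G y + D * (half_conv (gval F) x y / gval F x)"
  have lim_int: "((\<lambda>x. \<integral>y. ?B x y \<partial>lborel) \<longlongrightarrow> (\<integral>y. C * gval G y + D * gval F y \<partial>lborel)) at_top"
  proof -
    have "\<forall>\<^sub>F x in at_top. C * (\<integral>y. gval G y \<partial>lborel) +
        D * ((\<integral>y. half_conv (gval F) x y \<partial>lborel) / gval F x) = (\<integral>y. ?B x y \<partial>lborel)"
      using intF by eventually_elim (use G(3) in simp)
    moreover have "((\<lambda>x. C * (\<integral>y. gval G y \<partial>lborel) +
        D * ((\<integral>y. half_conv (gval F) x y \<partial>lborel) / gval F x)) \<longlongrightarrow>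
        C * (\<integral>y. gval G y \<partial>lborel) + D * (\<integral>y. gval F y \<partial>lborel)) at_top"
      by (intro tendsto_intros limF)
    ultimately have "((\<lambda>x. \<integral>y. ?B x y \<partial>lborel) \<longlongrightarrow>
        C * (\<integral>y. gval G y \<partial>lborel) + D * (\<integral>y. gval F y \<partial>lborel)) at_top"
      by (rule Lim_transform_eventually[rotated])
    then show ?thesis using F(3) G(3) by simp
  qed
  have bnd: "\<forall>\<^sub>F x in at_top. \<forall>y. 0 \<le> ?a x y \<and> ?a x y \<le> ?B x y"
    using bound by eventually_elim (use G(2) half_conv_nonneg[OF G(2)] in auto)
  have intB: "\<forall>\<^sub>F x in at_top. integrable lborel (?B x)"
    using intF by eventually_elim (use G(3) in auto)
  have lim_B: "((\<lambda>x. ?B x y) \<longlongrightarrow> C * gval G y + D * gval F y) at_top" for y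
    by (intro tendsto_intros tendsto_half_conv Fl)
  have int_lim: "integrable lborel (\<lambda>y. C * gval G y + D * gval F y)"
    using F(3) G(3) by auto
  have meas: "?a x \<in> borel_measurable lborel" "?B x \<in> borel_measurable lborel"
    "gval G \<in> borel_measurable lborel" for x
    by measurable
  note conv = dominated_convergence_moving_bound[of ?a lborel ?B "gval G",
      OF meas int_lim intB bnd tendsto_half_conv[OF Gl] lim_B lim_int]
  have "\<forall>\<^sub>F x in at_top. integrable lborel (half_conv (gval G) x)"
    using conv(1) long_tailed_eventually_pos[OF Gl]
    proof eventually_elim
      case (elim x)
      then show ?case using integrable_mult_right[OF elim(1), of "gval G x"] by simp
    qed
  moreover have "((\<lambda>x. (\<integral>y. half_conv (gval G) x y \<partial>lborel) / gval G x) \<longlongrightarrow> (\<integral>y. gval G y \<partial>lborel)) at_top"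
    using conv(2) by simp
  ultimately show ?thesis
    using subexponential_iff_half_conv[OF assms(2) Gl] by blast
qed

end
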